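(* Let $L$ be a language, and for every $n$ fix a probability distribution $\mathcal D_n$ on $\{0,1\}^n$. Let $k=k(n)=O(\lg n)$ and let $\Sigma=\bigcup_{i=0}^{\ell}\{0,1\}^i$ with $|\Sigma|=n^{O(1)}$. Suppose there are polynomial-size circuits $C_n$ and a help function $s:(\{0,1\}^n)^k\to\Sigma$ such that for all $x_1,\ldots,x_k\in\{0,1\}^n$, $C_n(x_1,\ldots,x_k,s(x_1,\ldots,x_k))=(L(x_1),\ldots,L(x_k))$. Let $X_1,\ldots,X_k$ be i.i.d. with distribution $\mathcal D_n$ and $S=s(X_1,\ldots,X_k)$. Assume that $\delta=\delta(n,k)$ satisfies $1/n^{O(1)}<\delta<1/2$ and $H(S)\le k-3k\delta$. Then there exist polynomial-size circuits (using no help) that, on $x$ drawn from $\mathcal D_n$, correctly compute $L(x)$ with probability at least $1/2+\delta$.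
   Context: $L(x)=1$ if $x\in L$ and $0$ otherwise. For a discrete random variable $X$, $H(X)=\sum_x \Pr[X=x]\lg_2\frac{1}{\Pr[X=x]}$ is its Shannon entropy. *)

theory Defs
  imports "HOL-Probability.Probability" "HOL-Library.Landau_Symbols"
begin

section \<open>Boolean circuits\<close>

text \<open>
  A circuit with m inputs is a straight-line program of gates of fan-in at most two.  Wires
  0, ..., m - 1 carry the inputs, and wire m + j carries the value of the j-th gate, which may
  refer to earlier wires only.  The size is the number of gates.
\<close>

datatype gate = ConstG bool | NotG nat | AndG nat nat | OrG nat nat

fun gate_wires :: "gate \<Rightarrow> nat set" where
  "gate_wires (ConstG b) = {}"
| "gate_wires (NotG i) = {i}"
| "gate_wires (AndG i j) = {i, j}"
| "gate_wires (OrG i j) = {i, j}"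

fun gate_val :: "bool list \<Rightarrow> gate \<Rightarrow> bool" where
  "gate_val vs (ConstG b) = b"
| "gate_val vs (NotG i) = (\<not> vs ! i)"
| "gate_val vs (AndG i j) = (vs ! i \<and> vs ! j)"
| "gate_val vs (OrG i j) = (vs ! i \<or> vs ! j)"

datatype circuit = Circuit (gates: "gate list") (outs: "nat list")

definition is_circuit :: "nat \<Rightarrow> nat \<Rightarrow> circuit \<Rightarrow> bool" where
  "is_circuit m r C \<longleftrightarrow>
     (\<forall>j < length (gates C). gate_wires (gates C ! j) \<subseteq> {..<m + j}) \<and>
     set (outs C) \<subseteq> {..<m + length (gates C)} \<and> length (outs C) = r"

definition circuit_eval :: "circuit \<Rightarrow> bool list \<Rightarrow> bool list" where
  "circuit_eval C x = map ((!) (foldl (\<lambda>vs g. vs @ [gate_val vs g]) x (gates C))) (outs C)"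

definition circuit_size :: "circuit \<Rightarrow> nat" where
  "circuit_size C = length (gates C)"

definition poly_bounded :: "(nat \<Rightarrow> nat) \<Rightarrow> bool" where
  "poly_bounded f \<longleftrightarrow> (\<exists>c::nat. (\<lambda>n. real (f n)) \<in> O(\<lambda>n. real n ^ c))"


section \<open>Strings, tuples and help\<close>

definition bitstrings :: "nat \<Rightarrow> bool list set" where
  "bitstrings n = {x. length x = n}"

definition tuples :: "nat \<Rightarrow> nat \<Rightarrow> bool list list set" where
  "tuples k n = {xs. length xs = k \<and> set xs \<subseteq> bitstrings n}"

definition help_alphabet :: "nat \<Rightarrow> bool list set" where
  "help_alphabet l = (\<Union>i\<le>l. bitstrings i)"

text \<open>
  A circuit has a fixed number of inputs, whereas the help strings have any length up to l.
  They are therefore given to the circuit in l + 1 bits, as the string, an end marker 1, and a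
  padding of 0s.
\<close>

definition encode_help :: "nat \<Rightarrow> bool list \<Rightarrow> bool list" where
  "encode_help l w = w @ True # replicate (l - length w) False"

lemma length_encode_help: "w \<in> help_alphabet l \<Longrightarrow> length (encode_help l w) = l + 1"
  by (auto simp: encode_help_def help_alphabet_def bitstrings_def)

lemma inj_on_encode_help: "inj_on (encode_help l) (help_alphabet l)"
proof (rule inj_on_inverseI)
  fix w
  have "dropWhile Not (replicate m False @ True # v) = True # v" for m v
    by (induction m) auto
  then show "rev (tl (dropWhile Not (rev (encode_help l w)))) = w"
    by (simp add: encode_help_def)
qed


section \<open>Shannon entropy\<close>

text \<open>
  This is the entropy of a random variable with law p, so that the entropy of f(X) for X with
  law q is that of \<^term>\<open>map_pmf f q\<close>.
\<close>

definition shannon_entropy :: "'a pmf \<Rightarrow> real" where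
  "shannon_entropy p = (\<Sum>\<^sub>\<infinity>x. pmf p x * log 2 (1 / pmf p x))"

lemma shannon_entropy_finite:
  assumes "finite (set_pmf p)"
  shows "shannon_entropy p = (\<Sum>x\<in>set_pmf p. pmf p x * log 2 (1 / pmf p x))"
proof -
  have "shannon_entropy p = (\<Sum>\<^sub>\<infinity>x\<in>set_pmf p. pmf p x * log 2 (1 / pmf p x))"
    unfolding shannon_entropy_def
    by (rule infsum_cong_neutral) (auto simp: set_pmf_iff)
  with assms show ?thesis by simp
qed

end

theory Submission imports Defs begin

text \<open>
  Let p be the law of the help string S and let W_i(x) be the p-probability that a help string
  drawn independently of x makes the circuit answer the first i of the k queries x correctly.
  Then W_0 = 1 and W_k(x) \<ge> p(s(x)), so the expectation of log (1 / W_k) is at most H(S).  Since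
  r \<ge> (1 + ln (2 r)) / 2, summing over the ratios r = W_(i+1) / W_i shows that for some i the
  expectation of W_(i+1) / W_i is at least 1/2 + \<delta>; the queries other than the i-th can then be
  fixed, their answers being hardwired.  The ratio is the success probability of the predictor that
  samples a help string among those that answer the first i queries correctly and outputs the answer
  to the next query.
  If the help strings are put in a random order, by drawing them without replacement with weights p,
  then the first string of that order that passes the test is such a sample.  Fixing the best
  order gives a decision list, which is a small circuit as there are only polynomially many help
  strings.
\<close>

section \<open>Building circuits\<close>

definition run :: "bool list \<Rightarrow> gate list \<Rightarrow> bool list" where
  "run x gs = foldl (\<lambda>vs g. vs @ [gate_val vs g]) x gs"

definition wf_gates :: "nat \<Rightarrow> gate list \<Rightarrow> bool" where
  "wf_gates m gs \<longleftrightarrow> (\<forall>j < length gs. gate_wires (gs ! j) \<subseteq> {..<m + j})"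

text \<open>Only an existing wire qualifies, and later gates never change its value. The property
  therefore survives appending gates, which is how all circuits below are built; well-formedness is
  tracked separately by \<open>wf_gates\<close>.\<close>

definition computes :: "nat \<Rightarrow> gate list \<Rightarrow> nat \<Rightarrow> (bool list \<Rightarrow> bool) \<Rightarrow> bool" where
  "computes m gs w f \<longleftrightarrow>
     w < m + length gs \<and> (\<forall>x. length x = m \<longrightarrow> run x gs ! w = f x)"

lemma run_Nil [simp]: "run x [] = x"
  by (simp add: run_def)

lemma run_snoc: "run x (gs @ [g]) = run x gs @ [gate_val (run x gs) g]"
  by (simp add: run_def)

lemma length_run [simp]: "length (run x gs) = length x + length gs"
  by (induction gs rule: rev_induct) (auto simp: run_snoc)

lemma run_append_nth: "w < length x + length gs \<Longrightarrow> run x (gs @ gs') ! w = run x gs ! w"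
  by (induction gs' rule: rev_induct)
     (auto simp: run_snoc nth_append simp flip: append_assoc)

lemma wf_gates_snoc:
  "wf_gates m (gs @ [g]) \<longleftrightarrow> wf_gates m gs \<and> gate_wires g \<subseteq> {..<m + length gs}"
  by (auto simp: wf_gates_def nth_append less_Suc_eq)

lemma computes_append: "computes m gs w f \<Longrightarrow> computes m (gs @ gs') w f"
  by (auto simp: computes_def run_append_nth)

lemma computes_cong:
  "computes m gs w f \<Longrightarrow> (\<And>x. length x = m \<Longrightarrow> f x = g x) \<Longrightarrow> computes m gs w g"
  by (auto simp: computes_def)

lemma computes_snoc:
  assumes "\<And>x. length x = m \<Longrightarrow> gate_val (run x gs) g = f x"
  shows "computes m (gs @ [g]) (m + length gs) f"
  using assms by (auto simp: computes_def run_snoc nth_append)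

lemma computes_and:
  assumes "computes m gs a f" "computes m gs b g"
  shows "computes m (gs @ [AndG a b]) (m + length gs) (\<lambda>x. f x \<and> g x)"
  using assms by (intro computes_snoc) (auto simp: computes_def)

lemma computes_or:
  assumes "computes m gs a f" "computes m gs b g"
  shows "computes m (gs @ [OrG a b]) (m + length gs) (\<lambda>x. f x \<or> g x)"
  using assms by (intro computes_snoc) (auto simp: computes_def)

lemma computes_not:
  assumes "computes m gs a f"
  shows "computes m (gs @ [NotG a]) (m + length gs) (\<lambda>x. \<not> f x)"
  using assms by (intro computes_snoc) (auto simp: computes_def)

text \<open>A multiplexer, built as (f and g) or (not f and h).\<close>

lemma computes_if:
  assumes "wf_gates m gs" "computes m gs a f" "computes m gs b g" "computes m gs d h"
  shows "\<exists>gs' w. wf_gates m (gs @ gs') \<and> length gs' = 4 \<and>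
           computes m (gs @ gs') w (\<lambda>x. if f x then g x else h x)"
proof -
  \<comment> \<open>\<open>N\<close> is the first new wire; \<open>N\<close>, \<open>N + 1\<close>
    and \<open>N + 2\<close> carry f and g, not f, and (not f) and h.\<close>
  define N where "N = m + length gs"
  define g1 where "g1 = gs @ [AndG a b]"
  define g2 where "g2 = g1 @ [NotG a]"
  define g3 where "g3 = g2 @ [AndG (N + 1) d]"
  define g4 where "g4 = g3 @ [OrG N (N + 2)]"
  have c1: "computes m g1 N (\<lambda>x. f x \<and> g x)"
    unfolding g1_def N_def by (rule computes_and) fact+
  have "computes m g2 (m + length g1) (\<lambda>x. \<not> f x)"
    unfolding g2_def by (intro computes_not) (auto simp: g1_def intro: computes_append assms)
  then have c2: "computes m g2 (N + 1) (\<lambda>x. \<not> f x)"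
    by (simp add: g1_def N_def)
  have "computes m g3 (m + length g2) (\<lambda>x. \<not> f x \<and> h x)"
    unfolding g3_def using c2
    by (intro computes_and) (auto simp: g1_def g2_def intro: computes_append assms)
  then have c3: "computes m g3 (N + 2) (\<lambda>x. \<not> f x \<and> h x)"
    by (simp add: g1_def g2_def N_def)
  have "computes m g4 (m + length g3) (\<lambda>x. f x \<and> g x \<or> \<not> f x \<and> h x)"
    unfolding g4_def using c1 c3
    by (intro computes_or) (auto simp: g2_def g3_def intro: computes_append)
  then have "computes m g4 (m + length g3) (\<lambda>x. if f x then g x else h x)"
    by (rule computes_cong) auto
  moreover have "g4 = gs @ [AndG a b, NotG a, AndG (N + 1) d, OrG N (N + 2)]"
    by (simp add: g1_def g2_def g3_def g4_def)
  moreover have "wf_gates m g4"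
    using assms unfolding g4_def g3_def g2_def g1_def wf_gates_snoc
    by (auto simp: N_def computes_def)
  ultimately show ?thesis
    by (intro exI[of _ "[AndG a b, NotG a, AndG (N + 1) d, OrG N (N + 2)]"] exI) auto
qed

text \<open>The expected bits \<open>c j\<close> are known when the circuit is built, so a
  comparison is the wire itself or its negation: one conjunction and at most one negation per bit.
  The constant wire \<open>t\<close> serves as the empty conjunction.\<close>

lemma computes_conj_eq:
  assumes "wf_gates m gs" "computes m gs t (\<lambda>x. True)"
    and "\<And>j. j < i \<Longrightarrow> computes m gs (a j) (f j)"
  shows "\<exists>gs' w. wf_gates m (gs @ gs') \<and> length gs' \<le> 2 * i \<and>
           computes m (gs @ gs') w (\<lambda>x. \<forall>j<i. f j x = c j)"
  using assms(3)
proof (induction i)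
  case 0
  show ?case
    using assms(1,2) by (intro exI[of _ "[]"] exI[of _ t]) simp
next
  case (Suc i)
  from Suc.IH Suc.prems obtain gs' w where
    IH: "wf_gates m (gs @ gs')" "length gs' \<le> 2 * i"
      "computes m (gs @ gs') w (\<lambda>x. \<forall>j<i. f j x = c j)"
    by auto
  have a: "computes m (gs @ gs') (a i) (f i)"
    by (intro computes_append Suc.prems) simp
  show ?case
  proof (cases "c i")
    case True
    from computes_and[OF IH(3) a]
    have "computes m (gs @ gs' @ [AndG w (a i)]) (m + length (gs @ gs'))
        (\<lambda>x. \<forall>j<Suc i. f j x = c j)"
      unfolding append_assoc by (rule computes_cong) (auto simp: less_Suc_eq True)
    moreover have "wf_gates m (gs @ gs' @ [AndG w (a i)])"
      unfolding append_assoc[symmetric] wf_gates_snoc using IH a by (auto simp: computes_def)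
    ultimately show ?thesis
      using IH(2) by (intro exI[of _ "gs' @ [AndG w (a i)]"] exI) auto
  next
    case False
    define h where "h = gs @ gs' @ [NotG (a i)]"
    have h: "computes m h (m + length (gs @ gs')) (\<lambda>x. \<not> f i x)"
      using computes_not[OF a] by (simp add: h_def)
    have w: "computes m h w (\<lambda>x. \<forall>j<i. f j x = c j)"
      using computes_append[OF IH(3)] by (simp add: h_def)
    have "computes m (h @ [AndG w (m + length (gs @ gs'))]) (m + length h)
        (\<lambda>x. \<forall>j<Suc i. f j x = c j)"
      by (rule computes_cong[OF computes_and[OF w h]]) (auto simp: less_Suc_eq False)
    moreover have "wf_gates m (h @ [AndG w (m + length (gs @ gs'))])"
      unfolding wf_gates_snoc h_def append_assoc[symmetric] using IH a w
      by (auto simp: computes_def h_def)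
    ultimately show ?thesis
      using IH(2)
      by (intro exI[of _ "gs' @ [NotG (a i), AndG w (m + length (gs @ gs'))]"] exI)
         (auto simp: h_def)
  qed
qed

fun map_wires :: "(nat \<Rightarrow> nat) \<Rightarrow> gate \<Rightarrow> gate" where
  "map_wires r (ConstG b) = ConstG b"
| "map_wires r (NotG i) = NotG (r i)"
| "map_wires r (AndG i j) = AndG (r i) (r j)"
| "map_wires r (OrG i j) = OrG (r i) (r j)"

text \<open>Inlines the program \<open>hs\<close> behind \<open>gs\<close>: the renaming
  \<open>r\<close> sends its input wires to the wires \<open>h j\<close> that already carry the
  substituted bits, and shifts its gate wires past \<open>gs\<close>. Copying inputs costs no
  gates.\<close>

lemma computes_subst:
  assumes gs: "wf_gates m gs" and hs: "wf_gates m' hs"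
    and h: "\<And>j. j < m' \<Longrightarrow> computes m gs (h j) (\<lambda>x. F x ! j)"
    and F: "\<And>x. length x = m \<Longrightarrow> length (F x) = m'"
  defines "r \<equiv> \<lambda>j. if j < m' then h j else m + length gs + (j - m')"
  shows "wf_gates m (gs @ map (map_wires r) hs) \<and>
    (\<forall>w < m' + length hs.
       computes m (gs @ map (map_wires r) hs) (r w) (\<lambda>x. run (F x) hs ! w))"
  using hs
proof (induction hs rule: rev_induct)
  case Nil
  then show ?case
    using gs h by (auto simp: r_def)
next
  case (snoc g hs)
  let ?G = "gs @ map (map_wires r) hs"
  from snoc.prems have hs: "wf_gates m' hs" and g: "gate_wires g \<subseteq> {..<m' + length hs}"
    by (auto simp: wf_gates_snoc)
  from snoc.IH[OF hs] have IH: "wf_gates m ?G"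
    "\<And>w. w < m' + length hs \<Longrightarrow> computes m ?G (r w) (\<lambda>x. run (F x) hs ! w)"
    by auto
  have wf: "wf_gates m (?G @ [map_wires r g])"
    using g IH unfolding wf_gates_snoc by (cases g) (auto simp: computes_def)
  have new: "computes m (?G @ [map_wires r g]) (m + length ?G)
      (\<lambda>x. run (F x) (hs @ [g]) ! (m' + length hs))"
  proof (rule computes_snoc)
    fix x :: "bool list" assume x: "length x = m"
    have "run x ?G ! r w = run (F x) hs ! w" if "w < m' + length hs" for w
      using IH(2)[OF that] x by (simp add: computes_def)
    then have "gate_val (run x ?G) (map_wires r g) = gate_val (run (F x) hs) g"
      using g by (cases g) auto
    then show "gate_val (run x ?G) (map_wires r g) = run (F x) (hs @ [g]) ! (m' + length hs)"
      using F[OF x] by (simp add: run_snoc nth_append)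
  qed
  have old: "computes m (?G @ [map_wires r g]) (r w) (\<lambda>x. run (F x) (hs @ [g]) ! w)"
    if "w < m' + length hs" for w
    by (rule computes_cong[OF computes_append[OF IH(2)[OF that]]])
       (use that in \<open>auto simp: run_snoc nth_append F\<close>)
  have "r (m' + length hs) = m + length ?G"
    by (simp add: r_def)
  then show ?case
    using wf new old by (auto simp: less_Suc_eq)
qed

section \<open>Decision lists\<close>

text \<open>The default \<open>False\<close> is reached only when every test fails;
  \<open>decision_list_exists\<close> credits such inputs with 0.\<close>

fun decide :: "('a \<Rightarrow> bool) \<Rightarrow> ('a \<Rightarrow> bool) \<Rightarrow> 'a list \<Rightarrow> bool" where
  "decide c v [] = False"
| "decide c v (a # as) = (if c a then v a else decide c v as)"

text \<open>The list is compiled from its tail. Each entry costs one copy of \<open>C\<close> with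
  \<open>pre a\<close> and \<open>post a\<close> hardwired, at most 2 i gates for the test and 4 for
  the multiplexer; the final 2 counts the constant gates.\<close>

lemma decision_list_circuit:
  assumes C: "is_circuit m' r C" and i: "i < r"
    and len: "\<And>a. a \<in> set as \<Longrightarrow> length (pre a) + m + length (post a) = m'"
  defines "E \<equiv> \<lambda>x a. circuit_eval C (pre a @ x @ post a)"
  shows "\<exists>C'. is_circuit m 1 C' \<and> circuit_size C' \<le> length as * (circuit_size C + 2 * i + 4) + 2 \<and>
    (\<forall>x. length x = m \<longrightarrow>
       circuit_eval C' x = [decide (\<lambda>a. \<forall>j<i. E x a ! j = c j) (\<lambda>a. E x a ! i) as])"
proof -
  \<comment> \<open>Starting every program with the two constants makes wires \<open>m\<close> and
    \<open>m + 1\<close> sources of True and False throughout the induction.\<close>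
  have "\<exists>gs w. wf_gates m ([ConstG True, ConstG False] @ gs) \<and>
      length gs \<le> length as * (circuit_size C + 2 * i + 4) \<and>
      computes m ([ConstG True, ConstG False] @ gs) w
        (\<lambda>x. decide (\<lambda>a. \<forall>j<i. E x a ! j = c j) (\<lambda>a. E x a ! i) as)"
    using len
  proof (induction as)
    case Nil
    have "computes m [ConstG True, ConstG False] (m + 1) (\<lambda>x. False)"
      by (auto simp: computes_def run_def nth_append)
    moreover have "wf_gates m [ConstG True, ConstG False]"
      by (auto simp: wf_gates_def less_Suc_eq)
    ultimately show ?case
      by auto
  next
    case (Cons a as)
    let ?K = "[ConstG True, ConstG False]"
    from Cons obtain gs w where IH: "wf_gates m (?K @ gs)"
        "length gs \<le> length as * (circuit_size C + 2 * i + 4)"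
        "computes m (?K @ gs) w
           (\<lambda>x. decide (\<lambda>a. \<forall>j<i. E x a ! j = c j) (\<lambda>a. E x a ! i) as)"
      by auto
    let ?F = "\<lambda>x. pre a @ x @ post a"
    have lena: "length (pre a) + m + length (post a) = m'"
      using Cons.prems by simp
    have T: "computes m (?K @ gs) m (\<lambda>x. True)"
      and F: "computes m (?K @ gs) (m + 1) (\<lambda>x. False)"
      by (rule computes_append; simp add: computes_def run_def nth_append)+
    \<comment> \<open>The wire carrying bit j of \<open>pre a @ x @ post a\<close>: a constant wire
      in the outer blocks, an input wire in the middle one.\<close>
    define h where "h j =
      (if j < length (pre a) then if pre a ! j then m else m + 1
       else if j < length (pre a) + m then j - length (pre a)
       else if post a ! (j - length (pre a) - m) then m else m + 1)" for j
    have h: "computes m (?K @ gs) (h j) (\<lambda>x. ?F x ! j)" for j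
    proof -
      consider (pre) "j < length (pre a)" | (mid) "j \<ge> length (pre a)" "j < length (pre a) + m"
        | (post) "j \<ge> length (pre a) + m" by linarith
      then show ?thesis
      proof cases
        case pre
        then show ?thesis
          using T F by (cases "pre a ! j") (simp_all add: h_def nth_append)
      next
        case mid
        have "run x (?K @ gs) ! (j - length (pre a)) = x ! (j - length (pre a))" if "length x = m" for x
          using run_append_nth[of "j - length (pre a)" x "[]" "?K @ gs"] that mid by simp
        with mid show ?thesis
          by (auto simp: computes_def h_def nth_append)
      next
        case post
        with T F have "computes m (?K @ gs) (h j) (\<lambda>x. post a ! (j - length (pre a) - m))"
          by (cases "post a ! (j - length (pre a) - m)") (simp_all add: h_def)
        then show ?thesis
          by (rule computes_cong) (use post in \<open>auto simp: nth_append\<close>)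
      qed
    qed
    have wfC: "wf_gates m' (gates C)" and outs: "length (outs C) = r"
        "set (outs C) \<subseteq> {..<m' + length (gates C)}"
      using C by (auto simp: is_circuit_def wf_gates_def)
    define \<rho> where "\<rho> = (\<lambda>j. if j < m' then h j else m + length (?K @ gs) + (j - m'))"
    define G where "G = gs @ map (map_wires \<rho>) (gates C)"
    have sub: "wf_gates m (?K @ G)"
      "\<And>w. w < m' + length (gates C) \<Longrightarrow>
         computes m (?K @ G) (\<rho> w) (\<lambda>x. run (?F x) (gates C) ! w)"
      using computes_subst[OF IH(1) wfC, of h ?F] h lena
      unfolding \<rho>_def G_def by auto
    have out: "computes m (?K @ G) (\<rho> (outs C ! j)) (\<lambda>x. E x a ! j)" if "j < r" for j
    proof -
      have "outs C ! j < m' + length (gates C)"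
        using that outs by (metis lessThan_iff nth_mem subsetD)
      from computes_cong[OF sub(2)[OF this]] show ?thesis
        using that outs by (auto simp: E_def circuit_eval_def run_def)
    qed
    have "computes m (?K @ G) m (\<lambda>x. True)"
      using computes_append[OF T] by (simp add: G_def)
    from computes_conj_eq[OF sub(1) this, of i "\<lambda>j. \<rho> (outs C ! j)" "\<lambda>j x. E x a ! j" c] out i
    obtain G1 w1 where G1: "wf_gates m ((?K @ G) @ G1)" "length G1 \<le> 2 * i"
        "computes m ((?K @ G) @ G1) w1 (\<lambda>x. \<forall>j<i. E x a ! j = c j)"
      by auto
    have "computes m ((?K @ G) @ G1) w
           (\<lambda>x. decide (\<lambda>a. \<forall>j<i. E x a ! j = c j) (\<lambda>a. E x a ! i) as)"
      using computes_append[OF IH(3)] by (simp add: G_def)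
    \<comment> \<open>Entry \<open>a\<close> takes precedence over the tail, whose answer is still
      on wire \<open>w\<close>.\<close>
    from computes_if[OF G1(1,3) computes_append[OF out[OF i]] this]
    obtain G2 w2 where G2: "wf_gates m (((?K @ G) @ G1) @ G2)" "length G2 = 4"
        "computes m (((?K @ G) @ G1) @ G2) w2
          (\<lambda>x. if \<forall>j<i. E x a ! j = c j then E x a ! i
               else decide (\<lambda>a. \<forall>j<i. E x a ! j = c j) (\<lambda>a. E x a ! i) as)"
      by blast
    have "length (G @ G1 @ G2) \<le> length (a # as) * (circuit_size C + 2 * i + 4)"
      using IH(2) G1(2) G2(2) by (simp add: G_def circuit_size_def)
    then show ?case
      using G2 by (intro exI[of _ "G @ G1 @ G2"] exI[of _ w2]) auto
  qed
  then obtain gs w where "wf_gates m ([ConstG True, ConstG False] @ gs)"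
      "length gs \<le> length as * (circuit_size C + 2 * i + 4)"
      "computes m ([ConstG True, ConstG False] @ gs) w
        (\<lambda>x. decide (\<lambda>a. \<forall>j<i. E x a ! j = c j) (\<lambda>a. E x a ! i) as)"
    by blast
  then show ?thesis
    by (intro exI[of _ "Circuit ([ConstG True, ConstG False] @ gs) [w]"])
       (auto simp: is_circuit_def wf_gates_def circuit_size_def circuit_eval_def computes_def run_def)
qed

text \<open>
  The quotient is the probability that the first element satisfying c, in the order in which T is
  drawn without replacement with weights p, has the right value.  The induction picks the
  first element so that the conditional expectation does not drop.
\<close>

lemma decision_list_exists:
  fixes p :: "'a \<Rightarrow> real" and w :: "'b \<Rightarrow> real"
  assumes "finite T" "finite X" "\<And>a. a \<in> T \<Longrightarrow> p a > 0" "\<And>x. x \<in> X \<Longrightarrow> w x \<ge> 0"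
  shows "\<exists>as. set as = T \<and> distinct as \<and>
    (\<Sum>x\<in>X. w x * (sum p {a\<in>T. c x a \<and> v x a = b x} / sum p {a\<in>T. c x a}))
      \<le> (\<Sum>x\<in>X. w x * of_bool (decide (c x) (v x) as = b x))"
  using assms
proof (induction "card T" arbitrary: T X)
  case 0
  \<comment> \<open>For empty T the quotients are 0 / 0 = 0, and the right side is
    nonnegative.\<close>
  then show ?case
    by (auto intro!: sum_nonneg)
next
  case (Suc N)
  \<comment> \<open>\<open>G x T\<close> is the success probability of a random order of T on x;
    \<open>V a\<close> is the expected total score when \<open>a\<close> comes first and the rest is
    in random order.\<close>
  define G where "G x T = sum p {a\<in>T. c x a \<and> v x a = b x} / sum p {a\<in>T. c x a}" for x T
  define V where "V a = (\<Sum>x\<in>X. w x * (if c x a then of_bool (v x a = b x) else G x (T - {a})))" for a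
  have "T \<noteq> {}"
    using Suc.hyps by auto
  then have P: "sum p T > 0"
    by (intro sum_pos Suc.prems)
  \<comment> \<open>Averaging over the first draw: entries passing the test contribute the weight of
    the correct ones, that is, the passing weight times \<open>G x T\<close>. Removing an entry that
    fails changes neither sum of the quotient, so it contributes its own weight times
    \<open>G x T\<close>.\<close>
  have pointwise: "(\<Sum>a\<in>T. p a * (if c x a then of_bool (v x a = b x) else G x (T - {a})))
      = sum p T * G x T" for x
  proof -
    have "(\<Sum>a\<in>T. p a * (if c x a then of_bool (v x a = b x) else G x (T - {a})))
        = (\<Sum>a\<in>T. (if c x a \<and> v x a = b x then p a else 0) + (if c x a then 0 else p a * G x T))"
    proof (rule sum.cong[OF refl])
      fix a assume "a \<in> T"
      have "G x (T - {a}) = G x T" if "\<not> c x a"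
      proof -
        have "{a'\<in>T - {a}. c x a' \<and> v x a' = b x} = {a'\<in>T. c x a' \<and> v x a' = b x}"
          "{a'\<in>T - {a}. c x a'} = {a'\<in>T. c x a'}" using that by auto
        then show ?thesis by (simp add: G_def)
      qed
      then show "p a * (if c x a then of_bool (v x a = b x) else G x (T - {a}))
        = (if c x a \<and> v x a = b x then p a else 0) + (if c x a then 0 else p a * G x T)"
        by auto
    qed
    also have "\<dots> = sum p {a\<in>T. c x a \<and> v x a = b x} + sum p {a\<in>T. \<not> c x a} * G x T"
    proof -
      have "(\<Sum>a\<in>T. if c x a then 0 else p a * G x T) = (\<Sum>a\<in>{a\<in>T. \<not> c x a}. p a * G x T)"
        using Suc.prems(1) by (subst sum.inter_filter) (auto intro: sum.cong)
      then show ?thesis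
        using Suc.prems(1) unfolding sum.distrib sum_distrib_right by (simp add: sum.inter_filter)
    qed
    also have "sum p {a\<in>T. c x a \<and> v x a = b x} = sum p {a\<in>T. c x a} * G x T"
    proof (cases "{a\<in>T. c x a} = {}")
      case True
      then have "{a\<in>T. c x a \<and> v x a = b x} = {}" by auto
      with True show ?thesis by (simp only: sum.empty)
    next
      case False
      then have "sum p {a\<in>T. c x a} > 0"
        using Suc.prems by (intro sum_pos) auto
      then show ?thesis by (simp add: G_def)
    qed
    also have "sum p {a\<in>T. c x a} * G x T + sum p {a\<in>T. \<not> c x a} * G x T
        = sum p ({a\<in>T. c x a} \<union> {a\<in>T. \<not> c x a}) * G x T"
      using Suc.prems(1) by (subst sum.union_disjoint) (auto simp: algebra_simps)
    also have "{a\<in>T. c x a} \<union> {a\<in>T. \<not> c x a} = T" by auto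
    finally show ?thesis .
  qed
  have "(\<Sum>a\<in>T. p a * V a)
      = (\<Sum>x\<in>X. w x * (\<Sum>a\<in>T. p a * (if c x a then of_bool (v x a = b x) else G x (T - {a}))))"
    unfolding V_def sum_distrib_left by (subst sum.swap) (simp add: mult.left_commute)
  also have "\<dots> = (\<Sum>a\<in>T. p a * (\<Sum>x\<in>X. w x * G x T))"
    unfolding pointwise sum_distrib_right[symmetric]
    by (simp add: sum_distrib_left[of "sum p T"] mult_ac)
  finally have avg: "(\<Sum>a\<in>T. p a * V a) = (\<Sum>a\<in>T. p a * (\<Sum>x\<in>X. w x * G x T))" .
  have "\<exists>a\<in>T. V a \<ge> (\<Sum>x\<in>X. w x * G x T)"
  proof (rule ccontr)
    assume "\<not> ?thesis"
    then have "(\<Sum>a\<in>T. p a * V a) < (\<Sum>a\<in>T. p a * (\<Sum>x\<in>X. w x * G x T))"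
      using \<open>T \<noteq> {}\<close> Suc.prems by (intro sum_strict_mono mult_strict_left_mono) auto
    with avg show False by simp
  qed
  then obtain a where a: "a \<in> T" "V a \<ge> (\<Sum>x\<in>X. w x * G x T)" by blast
  \<comment> \<open>Inputs on which \<open>a\<close> passes are settled, so the tail is chosen for
    the remaining ones only. This is why the induction generalizes over X as well.\<close>
  let ?X = "{x\<in>X. \<not> c x a}"
  have "\<exists>as. set as = T - {a} \<and> distinct as \<and>
    (\<Sum>x\<in>?X. w x * G x (T - {a})) \<le> (\<Sum>x\<in>?X. w x * of_bool (decide (c x) (v x) as = b x))"
    unfolding G_def using Suc.prems Suc.hyps(2) a(1) by (intro Suc.hyps(1)) auto
  then obtain as where as: "set as = T - {a}" "distinct as"
    "(\<Sum>x\<in>?X. w x * G x (T - {a})) \<le> (\<Sum>x\<in>?X. w x * of_bool (decide (c x) (v x) as = b x))"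
    by blast
  have split: "(\<Sum>x\<in>X. w x * (if c x a then f x else g x))
      = (\<Sum>x\<in>{x\<in>X. c x a}. w x * f x) + (\<Sum>x\<in>?X. w x * g x)" for f g :: "'b \<Rightarrow> real"
    using Suc.prems(2)
    by (simp add: sum.inter_filter if_distrib flip: sum.distrib) (auto intro!: sum.cong)
  have "(\<Sum>x\<in>X. w x * G x T) \<le> V a" by (rule a)
  also have "\<dots> \<le> (\<Sum>x\<in>{x\<in>X. c x a}. w x * of_bool (v x a = b x))
      + (\<Sum>x\<in>?X. w x * of_bool (decide (c x) (v x) as = b x))"
    unfolding V_def split using as(3) by simp
  also have "\<dots> = (\<Sum>x\<in>X. w x * of_bool (decide (c x) (v x) (a # as) = b x))"
    unfolding split[symmetric] by (rule sum.cong) auto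
  finally show ?case
    using a(1) as by (intro exI[of _ "a # as"]) (auto simp: G_def)
qed

section \<open>Removing the help\<close>

text \<open>Independent draws commute, so the old entry can be discarded and replaced by a fresh
  one. This exposes coordinate i as an inner draw while the others are held fixed.\<close>

lemma replicate_pmf_resample:
  "i < k \<Longrightarrow> replicate_pmf k p = replicate_pmf k p \<bind> (\<lambda>xs. map_pmf (\<lambda>x. xs[i := x]) p)"
proof (induction k arbitrary: i)
  case (Suc k)
  show ?case
  proof (cases i)
    case 0
    have "replicate_pmf (Suc k) p \<bind> (\<lambda>xs. map_pmf (\<lambda>x. xs[0 := x]) p)
        = replicate_pmf k p \<bind> (\<lambda>xs. p \<bind> (\<lambda>x. return_pmf (x # xs)))"
      by (simp add: bind_assoc_pmf bind_return_pmf map_pmf_def)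
    also have "\<dots> = replicate_pmf (Suc k) p"
      by (subst bind_commute_pmf) simp
    finally show ?thesis by (simp only: 0)
  next
    case (Suc j)
    with Suc.prems have "j < k" by simp
    have "replicate_pmf (Suc k) p \<bind> (\<lambda>xs. map_pmf (\<lambda>x. xs[i := x]) p)
        = p \<bind> (\<lambda>y. map_pmf ((#) y) (replicate_pmf k p \<bind> (\<lambda>xs. map_pmf (\<lambda>x. xs[j := x]) p)))"
      by (simp add: Suc bind_assoc_pmf bind_return_pmf map_pmf_def)
    also have "\<dots> = replicate_pmf (Suc k) p"
      unfolding Suc.IH[OF \<open>j < k\<close>, symmetric] by (simp add: map_pmf_def)
    finally show ?thesis ..
  qed
qed simp

lemma finite_set_replicate_pmf: "finite (set_pmf p) \<Longrightarrow> finite (set_pmf (replicate_pmf k p))"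
  by (simp add: set_replicate_pmf lists_eq_set finite_lists_length_eq)

text \<open>The expectation is an average over \<open>ys\<close> of expectations over a fresh
  coordinate i, so some \<open>ys\<close> is at least average. Taking it from the support ensures
  later that its entries are strings of length n.\<close>

lemma fix_other_coordinates:
  fixes f :: "'a list \<Rightarrow> real"
  assumes "i < k" "finite (set_pmf p)" "r \<le> measure_pmf.expectation (replicate_pmf k p) f"
  shows "\<exists>ys \<in> set_pmf (replicate_pmf k p). r \<le> measure_pmf.expectation p (\<lambda>x. f (ys[i := x]))"
proof (rule ccontr)
  let ?R = "replicate_pmf k p" and ?g = "\<lambda>ys. measure_pmf.expectation p (\<lambda>x. f (ys[i := x]))"
  assume neg: "\<not> ?thesis"
  have fin: "finite (set_pmf ?R)"
    using assms(2) by (rule finite_set_replicate_pmf)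
  have "measure_pmf.expectation ?R f
      = measure_pmf.expectation (?R \<bind> (\<lambda>xs. map_pmf (\<lambda>x. xs[i := x]) p)) f"
    by (subst replicate_pmf_resample[OF assms(1)]) simp
  also have "\<dots> = (\<Sum>ys\<in>set_pmf ?R. pmf ?R ys *\<^sub>R ?g ys)"
    using fin assms(2) by (subst pmf_expectation_bind[OF fin]) auto
  also have "\<dots> < (\<Sum>ys\<in>set_pmf ?R. pmf ?R ys * r)"
    using neg fin by (intro sum_strict_mono) (auto simp: set_pmf_not_empty pmf_positive_iff)
  also have "\<dots> = r"
    using fin by (simp add: sum_pmf_eq_1 flip: sum_distrib_right)
  finally show False
    using assms(3) by simp
qed

lemma finite_bitstrings: "finite (bitstrings n)"
  using finite_lists_length_eq[of "UNIV :: bool set" n] by (simp add: bitstrings_def)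

lemma finite_help_alphabet: "finite (help_alphabet l)"
  by (simp add: help_alphabet_def finite_bitstrings)

section \<open>Entropy and the predictable query\<close>

text \<open>Writes the entropy as an expectation over the source variable, so that it can be bounded
  pointwise in the tuple of queries.\<close>

lemma shannon_entropy_map_pmf:
  assumes "finite (set_pmf p)"
  shows "shannon_entropy (map_pmf f p)
    = measure_pmf.expectation p (\<lambda>x. log 2 (1 / pmf (map_pmf f p) (f x)))"
proof -
  let ?q = "map_pmf f p"
  have "shannon_entropy ?q = (\<Sum>y\<in>set_pmf ?q. log 2 (1 / pmf ?q y) * pmf ?q y)"
    using assms by (subst shannon_entropy_finite) (auto simp: mult.commute)
  also have "\<dots> = measure_pmf.expectation ?q (\<lambda>y. log 2 (1 / pmf ?q y))"
    using assms by (intro integral_measure_pmf_real[symmetric]) auto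
  finally show ?thesis by simp
qed

text \<open>The tangent bound ln t \<le> t - 1 at t = 2 r. Equality holds at r = 1/2, the success
  rate of blind guessing.\<close>

lemma half_ln_le:
  fixes r :: real
  assumes "r > 0"
  shows "(1 + ln 2 + ln r) / 2 \<le> r"
  using ln_le_minus_one[of "2 * r"] assms by (simp add: ln_mult)

lemma good_coordinate:
  fixes A :: "'a list \<Rightarrow> 'b \<Rightarrow> bool list" and D :: "'a pmf" and b :: "'a \<Rightarrow> bool"
  assumes fin: "finite (set_pmf D)" and k: "k \<ge> 1" and "\<delta> \<ge> 0"
    and ent: "shannon_entropy (map_pmf s (replicate_pmf k D)) \<le> real k - 3 * real k * \<delta>"
    and correct: "\<And>xs. xs \<in> set_pmf (replicate_pmf k D) \<Longrightarrow> A xs (s xs) = map b xs"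
  defines "q \<equiv> map_pmf s (replicate_pmf k D)"
  defines "W \<equiv> \<lambda>i xs. sum (pmf q) {a \<in> set_pmf q. \<forall>j<i. A xs a ! j = b (xs ! j)}"
  shows "\<exists>i<k. 1 / 2 + \<delta> \<le> measure_pmf.expectation (replicate_pmf k D) (\<lambda>xs. W (Suc i) xs / W i xs)"
proof (rule ccontr)
  let ?R = "replicate_pmf k D"
  assume neg: "\<not> ?thesis"
  have finR: "finite (set_pmf ?R)"
    using fin by (rule finite_set_replicate_pmf)
  have finq: "finite (set_pmf q)"
    using finR by (simp add: q_def)
  have int: "integrable (measure_pmf ?R) f" for f :: "'a list \<Rightarrow> real"
    using finR by (rule integrable_measure_pmf_finite)
  have pos: "pmf q (s xs) > 0" if "xs \<in> set_pmf ?R" for xs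
    using that by (auto simp: q_def pmf_positive_iff)
  \<comment> \<open>The true help string \<open>s xs\<close> passes every test, so its weight is
    always counted. This also keeps all \<open>W i xs\<close> positive, as the logarithms below
    require.\<close>
  have Wge: "W i xs \<ge> pmf q (s xs)" if xs: "xs \<in> set_pmf ?R" and "i \<le> k" for i xs
  proof -
    have "length xs = k"
      using xs by (auto simp: set_replicate_pmf)
    then have "s xs \<in> {a \<in> set_pmf q. \<forall>j<i. A xs a ! j = b (xs ! j)}"
      using correct[OF xs] xs \<open>i \<le> k\<close> by (auto simp: q_def)
    then show ?thesis
      unfolding W_def using finq by (intro member_le_sum) auto
  qed
  have W0: "W 0 xs = 1" for xs
    unfolding W_def using finq by (simp add: sum_pmf_eq_1)
  have pointwise: "(real k + real k * ln 2 + ln (pmf q (s xs))) / 2 \<le> (\<Sum>i<k. W (Suc i) xs / W i xs)"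
    if xs: "xs \<in> set_pmf ?R" for xs
  proof -
    have Wpos: "W i xs > 0" if "i \<le> k" for i
      using Wge[OF xs that] pos[OF xs] by linarith
    \<comment> \<open>The tangent bound applied to each ratio; the logarithms telescope from
      \<open>W 0 xs\<close> = 1 to \<open>W k xs\<close>.\<close>
    have "(\<Sum>i<k. (1 + ln 2 + (ln (W (Suc i) xs) - ln (W i xs))) / 2) \<le> (\<Sum>i<k. W (Suc i) xs / W i xs)"
    proof (rule sum_mono)
      fix i assume "i \<in> {..<k}"
      then have "W (Suc i) xs > 0" "W i xs > 0"
        by (auto intro: Wpos)
      then have ln_W: "ln (W (Suc i) xs / W i xs) = ln (W (Suc i) xs) - ln (W i xs)"
        and "W (Suc i) xs / W i xs > 0"
        by (simp_all add: ln_div)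
      then show "(1 + ln 2 + (ln (W (Suc i) xs) - ln (W i xs))) / 2 \<le> W (Suc i) xs / W i xs"
        unfolding ln_W[symmetric] by (intro half_ln_le)
    qed
    also have "(\<Sum>i<k. (1 + ln 2 + (ln (W (Suc i) xs) - ln (W i xs))) / 2)
        = (real k + real k * ln 2 + (ln (W k xs) - ln (W 0 xs))) / 2"
      using sum_lessThan_telescope[of "\<lambda>i. ln (W i xs)" k]
      unfolding sum_divide_distrib[symmetric] sum.distrib by (simp only: sum_constant card_lessThan) simp
    finally have sum_ge: "(real k + real k * ln 2 + ln (W k xs)) / 2
        \<le> (\<Sum>i<k. W (Suc i) xs / W i xs)"
      by (simp add: W0)
    have "ln (pmf q (s xs)) \<le> ln (W k xs)"
      using Wge[OF xs order_refl] pos[OF xs] by simp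
    then have "(real k + real k * ln 2 + ln (pmf q (s xs))) / 2
        \<le> (real k + real k * ln 2 + ln (W k xs)) / 2"
      by simp
    then show ?thesis
      using sum_ge by (rule order_trans)
  qed
  have "measure_pmf.expectation ?R (\<lambda>xs. log 2 (1 / pmf q (s xs))) \<le> real k - 3 * real k * \<delta>"
    using ent shannon_entropy_map_pmf[OF finR, of s] by (simp add: q_def)
  moreover have "measure_pmf.expectation ?R (\<lambda>xs. log 2 (1 / pmf q (s xs)))
      = - measure_pmf.expectation ?R (\<lambda>xs. ln (pmf q (s xs))) / ln 2"
  proof -
    have "measure_pmf.expectation ?R (\<lambda>xs. log 2 (1 / pmf q (s xs)))
      = measure_pmf.expectation ?R (\<lambda>xs. (- 1 / ln 2) * ln (pmf q (s xs)))"
      by (intro integral_cong_AE) (auto simp: AE_measure_pmf_iff log_def ln_div dest!: pos)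
    then show ?thesis by simp
  qed
  ultimately have "- measure_pmf.expectation ?R (\<lambda>xs. ln (pmf q (s xs)))
      \<le> (real k - 3 * real k * \<delta>) * ln 2"
    by (subst pos_divide_le_eq[symmetric]) simp_all
  \<comment> \<open>Origin of the factor 3 in the entropy gap: 3 ln 2 \<ge> 2, so after halving, the
    gap still yields \<delta> per query.\<close>
  moreover have "real k * \<delta> * 2 \<le> 3 * real k * \<delta> * ln 2"
    using mult_left_mono[OF ln2_ge_two_thirds, of "3 * real k * \<delta>"] \<open>\<delta> \<ge> 0\<close>
    by (simp add: mult.commute)
  ultimately have "real k * (1 / 2 + \<delta>)
      \<le> (real k + real k * ln 2 + measure_pmf.expectation ?R (\<lambda>xs. ln (pmf q (s xs)))) / 2"
    by (simp add: algebra_simps)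
  also have "\<dots> = measure_pmf.expectation ?R (\<lambda>xs. (real k + real k * ln 2 + ln (pmf q (s xs))) / 2)"
    by (simp add: int)
  also have "\<dots> \<le> measure_pmf.expectation ?R (\<lambda>xs. \<Sum>i<k. W (Suc i) xs / W i xs)"
    using pointwise by (intro integral_mono_AE int) (unfold AE_measure_pmf_iff, blast)
  also have "\<dots> = (\<Sum>i<k. measure_pmf.expectation ?R (\<lambda>xs. W (Suc i) xs / W i xs))"
    by (intro Bochner_Integration.integral_sum int)
  also have "\<dots> < (\<Sum>i<k. 1 / 2 + \<delta>)"
    using neg k by (intro sum_strict_mono) (auto simp: not_le lessThan_empty_iff)
  finally show False by simp
qed

section \<open>Assembling the circuit for one input length\<close>

text \<open>The size bound allots one block to each string of the help alphabet; 2 k dominates the 2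
  i gates that test the i < k earlier answers.\<close>

lemma circuit_without_help:
  fixes L :: "bool list set" and D :: "bool list pmf" and \<delta> :: real
  assumes D: "set_pmf D \<subseteq> bitstrings n" and k: "k \<ge> 1"
    and C: "is_circuit (k * n + (l + 1)) k C"
    and s: "\<And>xs. xs \<in> tuples k n \<Longrightarrow> s xs \<in> help_alphabet l"
    and correct: "\<And>xs. xs \<in> tuples k n \<Longrightarrow>
      circuit_eval C (concat xs @ encode_help l (s xs)) = map (\<lambda>x. x \<in> L) xs"
    and \<delta>: "\<delta> \<ge> 0"
    and ent: "shannon_entropy (map_pmf s (replicate_pmf k D)) \<le> real k - 3 * real k * \<delta>"
  shows "\<exists>C'. is_circuit n 1 C' \<and>
    circuit_size C' \<le> card (help_alphabet l) * (circuit_size C + 2 * k + 4) + 2 \<and>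
    measure_pmf.prob D {x. circuit_eval C' x = [x \<in> L]} \<ge> 1 / 2 + \<delta>"
proof -
  let ?R = "replicate_pmf k D"
  define T where "T = set_pmf (map_pmf s ?R)"
  define p where "p = pmf (map_pmf s ?R)"
  define A where "A xs a = circuit_eval C (concat xs @ encode_help l a)" for xs a
  define W where "W i xs = sum p {a \<in> T. \<forall>j<i. A xs a ! j = (xs ! j \<in> L)}" for i xs
  have fin: "finite (set_pmf D)"
    using D finite_bitstrings by (rule finite_subset)
  have R: "xs \<in> tuples k n" if "xs \<in> set_pmf ?R" for xs
    using that D by (auto simp: set_replicate_pmf tuples_def)
  have T: "T \<subseteq> help_alphabet l"
    using R s by (auto simp: T_def)
  then have finT: "finite T"
    using finite_help_alphabet by (rule finite_subset)
  obtain i where i: "i < k"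
    and "1 / 2 + \<delta> \<le> measure_pmf.expectation ?R (\<lambda>xs. W (Suc i) xs / W i xs)"
    using good_coordinate[OF fin k \<delta> ent, of A "\<lambda>x. x \<in> L"] R correct
    unfolding A_def W_def T_def p_def by blast
  from fix_other_coordinates[OF i fin this(2)] obtain ys where ys: "ys \<in> set_pmf ?R"
    and "1 / 2 + \<delta> \<le> measure_pmf.expectation D (\<lambda>x. W (Suc i) (ys[i := x]) / W i (ys[i := x]))"
    by blast
  then have bound: "1 / 2 + \<delta>
      \<le> (\<Sum>x\<in>set_pmf D. pmf D x * (W (Suc i) (ys[i := x]) / W i (ys[i := x])))"
    using fin by (simp add: integral_measure_pmf_real[OF fin] mult.commute)
  from R[OF ys] have len: "length ys = k" and lens: "\<And>y. y \<in> set ys \<Longrightarrow> length y = n"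
    by (auto simp: tuples_def bitstrings_def)
  \<comment> \<open>Below i the tuples \<open>ys[i := x]\<close> and \<open>ys\<close> agree, so the
    correct earlier answers do not depend on x and can be hardwired.\<close>
  define c where "c x a \<longleftrightarrow> (\<forall>j<i. A (ys[i := x]) a ! j = (ys ! j \<in> L))" for x a
  define v where "v x a = A (ys[i := x]) a ! i" for x a
  have W: "W i (ys[i := x]) = sum p {a \<in> T. c x a}"
    "W (Suc i) (ys[i := x]) = sum p {a \<in> T. c x a \<and> v x a = (x \<in> L)}" for x
    unfolding W_def c_def v_def using i len
    by (auto intro!: arg_cong[where f = "sum p"] simp: less_Suc_eq)
  have "\<exists>as. set as = T \<and> distinct as \<and>
    (\<Sum>x\<in>set_pmf D. pmf D x * (sum p {a\<in>T. c x a \<and> v x a = (x \<in> L)} / sum p {a\<in>T. c x a}))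
      \<le> (\<Sum>x\<in>set_pmf D. pmf D x * of_bool (decide (c x) (v x) as = (x \<in> L)))"
    using fin finT by (intro decision_list_exists) (auto simp: p_def T_def pmf_positive_iff)
  then obtain as where as: "set as = T" "distinct as"
    and exp: "(\<Sum>x\<in>set_pmf D. pmf D x * (W (Suc i) (ys[i := x]) / W i (ys[i := x])))
      \<le> (\<Sum>x\<in>set_pmf D. pmf D x * of_bool (decide (c x) (v x) as = (x \<in> L)))"
    unfolding W by blast
  note bound
  also note exp
  also have "(\<Sum>x\<in>set_pmf D. pmf D x * of_bool (decide (c x) (v x) as = (x \<in> L)))
      = (\<Sum>x\<in>{x \<in> set_pmf D. decide (c x) (v x) as = (x \<in> L)}. pmf D x)"
    unfolding sum.inter_filter[OF fin] by (intro sum.cong) auto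
  also have "\<dots> = measure_pmf.prob D {x \<in> set_pmf D. decide (c x) (v x) as = (x \<in> L)}"
    using fin by (intro measure_measure_pmf_finite[symmetric]) simp
  finally have prob: "1 / 2 + \<delta>
      \<le> measure_pmf.prob D {x \<in> set_pmf D. decide (c x) (v x) as = (x \<in> L)}" .
  define pre where "pre = concat (take i ys)"
  define post where "post = concat (drop (Suc i) ys)"
  have conc: "concat (ys[i := x]) = pre @ x @ post" for x
    using i len by (simp add: upd_conv_take_nth_drop pre_def post_def)
  have "length (concat xs) = length xs * n" if "set xs \<subseteq> set ys" for xs
    using that lens by (induction xs) auto
  from this[of ys] conc[of "ys ! i"] have lenpp: "length pre + n + length post = k * n"
    using len i lens by (auto dest!: arg_cong[where f = length])
  \<comment> \<open>The encoded help string joins the fixed later queries in the constant suffix, so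
    x is the only genuine input left.\<close>
  have "\<exists>C'. is_circuit n 1 C' \<and> circuit_size C' \<le> length as * (circuit_size C + 2 * i + 4) + 2 \<and>
    (\<forall>x. length x = n \<longrightarrow> circuit_eval C' x =
       [decide (\<lambda>a. \<forall>j<i. circuit_eval C (pre @ x @ (post @ encode_help l a)) ! j = (ys ! j \<in> L))
          (\<lambda>a. circuit_eval C (pre @ x @ (post @ encode_help l a)) ! i) as])"
    using i lenpp T as(1)
    by (intro decision_list_circuit[OF C]) (auto simp: subset_iff dest!: length_encode_help)
  then obtain C' where C': "is_circuit n 1 C'"
    "circuit_size C' \<le> length as * (circuit_size C + 2 * i + 4) + 2"
    "\<And>x. length x = n \<Longrightarrow> circuit_eval C' x = [decide (c x) (v x) as]"
    by (auto simp: c_def [abs_def] v_def [abs_def] A_def conc)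
  have "length as \<le> card (help_alphabet l)"
    using as T card_mono[OF finite_help_alphabet T] distinct_card[of as] by simp
  then have "length as * (circuit_size C + 2 * i + 4)
      \<le> card (help_alphabet l) * (circuit_size C + 2 * k + 4)"
    using i by (intro mult_le_mono) auto
  with C'(2) have "circuit_size C' \<le> card (help_alphabet l) * (circuit_size C + 2 * k + 4) + 2"
    by linarith
  moreover have "measure_pmf.prob D {x \<in> set_pmf D. decide (c x) (v x) as = (x \<in> L)}
      \<le> measure_pmf.prob D {x. circuit_eval C' x = [x \<in> L]}"
    using C'(3) D by (intro measure_pmf.finite_measure_mono) (auto simp: bitstrings_def)
  ultimately show ?thesis
    using C'(1) prob by fastforce
qed

text \<open>The better of the two constant answers. It covers input lengths with negative \<delta>,
  where success probability 1/2 is enough.\<close>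

lemma constant_circuit:
  fixes D :: "bool list pmf"
  assumes "set_pmf D \<subseteq> bitstrings n"
  shows "\<exists>C'. is_circuit n 1 C' \<and> circuit_size C' = 1 \<and>
    measure_pmf.prob D {x. circuit_eval C' x = [x \<in> L]} \<ge> 1 / 2"
proof -
  have "measure_pmf.prob D (- L) = 1 - measure_pmf.prob D L"
    using measure_pmf.prob_compl[of L D] by (simp add: Compl_eq_Diff_UNIV)
  then have "measure_pmf.prob D L \<ge> 1 / 2 \<or> measure_pmf.prob D (- L) \<ge> 1 / 2"
    by linarith
  then have "\<exists>b. measure_pmf.prob D {x. b = (x \<in> L)} \<ge> 1 / 2"
    by (auto simp: ex_bool_eq Compl_eq)
  then obtain b where b: "measure_pmf.prob D {x. b = (x \<in> L)} \<ge> 1 / 2"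
    by blast
  let ?C = "Circuit [ConstG b] [n]"
  have "measure_pmf.prob D {x. b = (x \<in> L)} = measure_pmf.prob D {x. circuit_eval ?C x = [x \<in> L]}"
    using assms
    by (intro measure_pmf.finite_measure_eq_AE)
       (auto simp: AE_measure_pmf_iff bitstrings_def circuit_eval_def nth_append)
  with b show ?thesis
    by (intro exI[of _ ?C]) (auto simp: is_circuit_def circuit_size_def)
qed

section \<open>Polynomial growth bounds\<close>

lemma poly_bounded_const: "poly_bounded (\<lambda>n. a)"
  unfolding poly_bounded_def by (intro exI[of _ 0]) simp

lemma poly_bounded_mono:
  assumes "poly_bounded g" "\<And>n. f n \<le> g n"
  shows "poly_bounded f"
proof -
  have "(\<lambda>n. real (f n)) \<in> O(\<lambda>n. real (g n))"
    using assms(2) by (intro bigoI[of _ 1] always_eventually) auto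
  then show ?thesis
    using assms(1) unfolding poly_bounded_def by (blast intro: landau_o.big_trans)
qed

lemma poly_bounded_mult:
  assumes "poly_bounded f" "poly_bounded g"
  shows "poly_bounded (\<lambda>n. f n * g n)"
proof -
  obtain c d where "(\<lambda>n. real (f n)) \<in> O(\<lambda>n. real n ^ c)" "(\<lambda>n. real (g n)) \<in> O(\<lambda>n. real n ^ d)"
    using assms by (auto simp: poly_bounded_def)
  then have "(\<lambda>n. real (f n) * real (g n)) \<in> O(\<lambda>n. real n ^ c * real n ^ d)"
    by (rule landau_o.big.mult)
  then show ?thesis
    unfolding poly_bounded_def by (intro exI[of _ "c + d"]) (simp add: power_add)
qed

lemma power_bigo_power: "c \<le> d \<Longrightarrow> (\<lambda>n. real n ^ c) \<in> O(\<lambda>n. real n ^ d)"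
  by (intro bigoI[of _ 1] eventually_at_top_linorderI[of 1]) (auto intro: power_increasing)

lemma poly_bounded_add:
  assumes "poly_bounded f" "poly_bounded g"
  shows "poly_bounded (\<lambda>n. f n + g n)"
proof -
  obtain c d where "(\<lambda>n. real (f n)) \<in> O(\<lambda>n. real n ^ c)" "(\<lambda>n. real (g n)) \<in> O(\<lambda>n. real n ^ d)"
    using assms by (auto simp: poly_bounded_def)
  then have "(\<lambda>n. real (f n)) \<in> O(\<lambda>n. real n ^ max c d)" "(\<lambda>n. real (g n)) \<in> O(\<lambda>n. real n ^ max c d)"
    by (auto intro: landau_o.big_trans[OF _ power_bigo_power])
  then have "(\<lambda>n. real (f n) + real (g n)) \<in> O(\<lambda>n. real n ^ max c d)"
    by (rule sum_in_bigo)
  then show ?thesis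
    unfolding poly_bounded_def by auto
qed

lemma poly_bounded_log:
  assumes "(\<lambda>n. real (f n)) \<in> O(\<lambda>n. log 2 (real n))"
  shows "poly_bounded f"
proof -
  have "(\<lambda>n. log 2 (real n)) \<in> O(\<lambda>n. real n)"
  proof (intro bigoI[of _ 1] eventually_at_top_linorderI[of 1])
    fix n :: nat assume "1 \<le> n"
    moreover have "real n \<le> 2 powr real n"
      by (simp add: powr_realpow less_imp_le)
    ultimately show "norm (log 2 (real n)) \<le> 1 * norm (real n)"
      by (simp add: log_le_iff)
  qed
  with assms have "(\<lambda>n. real (f n)) \<in> O(\<lambda>n. real n)"
    by (rule landau_o.big_trans)
  then show ?thesis
    unfolding poly_bounded_def by (intro exI[of _ 1]) simp
qed

theorem theorem4p1:
  fixes L :: "bool list set"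
    and D :: "nat \<Rightarrow> bool list pmf"
    and k l :: "nat \<Rightarrow> nat"
    and C :: "nat \<Rightarrow> circuit"
    and s :: "nat \<Rightarrow> bool list list \<Rightarrow> bool list"
    and \<delta> :: "nat \<Rightarrow> real"
  assumes "\<And>n. set_pmf (D n) \<subseteq> bitstrings n"
    and "\<And>n. k n \<ge> 1"
    and "(\<lambda>n. real (k n)) \<in> O(\<lambda>n. log 2 (real n))"
    and "poly_bounded (\<lambda>n. card (help_alphabet (l n)))"
    and "\<And>n. is_circuit (k n * n + (l n + 1)) (k n) (C n)"
    and "poly_bounded (\<lambda>n. circuit_size (C n))"
    and "\<And>n xs. xs \<in> tuples (k n) n \<Longrightarrow> s n xs \<in> help_alphabet (l n)"
    and "\<And>n xs. xs \<in> tuples (k n) n \<Longrightarrow>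
           circuit_eval (C n) (concat xs @ encode_help (l n) (s n xs)) = map (\<lambda>x. x \<in> L) xs"
    and "\<exists>c::nat. \<forall>\<^sub>F n in at_top. 1 / real n ^ c < \<delta> n"
    and "\<And>n. \<delta> n < 1 / 2"
    and "\<And>n. shannon_entropy (map_pmf (s n) (replicate_pmf (k n) (D n)))
                \<le> real (k n) - 3 * real (k n) * \<delta> n"
  shows "\<exists>C' :: nat \<Rightarrow> circuit.
           poly_bounded (\<lambda>n. circuit_size (C' n)) \<and>
           (\<forall>n. is_circuit n 1 (C' n) \<and>
                measure_pmf.prob (D n) {x. circuit_eval (C' n) x = [x \<in> L]} \<ge> 1 / 2 + \<delta> n)"
proof -
  \<comment> \<open>One size bound for both cases; the summand 2 also leaves room for the one-gate
    constant circuit.\<close>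
  define b where "b n = card (help_alphabet (l n)) * (circuit_size (C n) + 2 * k n + 4) + 2" for n
  have "\<exists>C'. is_circuit n 1 C' \<and> circuit_size C' \<le> b n \<and>
      measure_pmf.prob (D n) {x. circuit_eval C' x = [x \<in> L]} \<ge> 1 / 2 + \<delta> n" for n
  proof (cases "\<delta> n \<ge> 0")
    case True
    then show ?thesis
      unfolding b_def using assms by (intro circuit_without_help) auto
  next
    case False
    with constant_circuit[OF assms(1), of n L] show ?thesis
      by (fastforce simp: b_def)
  qed
  then obtain C' where C': "\<And>n. is_circuit n 1 (C' n)" "\<And>n. circuit_size (C' n) \<le> b n"
      "\<And>n. measure_pmf.prob (D n) {x. circuit_eval (C' n) x = [x \<in> L]} \<ge> 1 / 2 + \<delta> n"
    by metis
  have "poly_bounded b"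
    unfolding b_def
    by (intro poly_bounded_add poly_bounded_mult poly_bounded_const poly_bounded_log assms)
  with C' show ?thesis
    by (auto intro: poly_bounded_mono)
qed

end
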